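(* Let $f:\mathbb{D}^2\to\mathbb{D}$ be a holomorphic function which is everywhere infinitesimally extremal and which extends continuously to the closed bidisk $\overline{\mathbb{D}}\times\overline{\mathbb{D}}$. Then $f$ depends on only one variable and is an automorphism of the disk in that variable; that is, there is a (holomorphic) automorphism $\phi$ of $\mathbb{D}$ such that either $f(z,w)=\phi(z)$ for all $(z,w)\in\mathbb{D}^2$, or $f(z,w)=\phi(w)$ for all $(z,w)\in\mathbb{D}^2$.
   Context: $\mathbb{D}=\{\zeta\in\mathbb{C}:|\zeta|<1\}$ is the open unit disk and $\mathbb{D}^2=\mathbb{D}\times\mathbb{D}$ is the bidisk. A holomorphic function $f:\mathbb{D}^2\to\mathbb{D}$ is called everywhere infinitesimally extremal if $$(1-|z|^2)\left|\frac{\partial f}{\partial z}(z,w)\right|+(1-|w|^2)\left|\frac{\partial f}{\partial w}(z,w)\right|=1-|f(z,w)|^2$$ for every $(z,w)\in\mathbb{D}^2$. *)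

theory Defs
  imports "HOL-Complex_Analysis.Complex_Analysis"
begin

abbreviation unit_disk :: "complex set" where
  "unit_disk \<equiv> ball 0 1"

abbreviation bidisk :: "(complex \<times> complex) set" where
  "bidisk \<equiv> unit_disk \<times> unit_disk"

text \<open>
  Holomorphy in two variables is meant on open sets: total differentiability with a
  complex-linear derivative.
\<close>

definition holomorphic2_on ::
    "(complex \<times> complex \<Rightarrow> complex) \<Rightarrow> (complex \<times> complex) set \<Rightarrow> bool"
    (infixl "holomorphic2'_on" 50) where
  "f holomorphic2_on S \<longleftrightarrow>
     (\<forall>p\<in>S. \<exists>a b. (f has_derivative (\<lambda>h. a * fst h + b * snd h)) (at p within S))"

definition partial_z :: "(complex \<times> complex \<Rightarrow> complex) \<Rightarrow> complex \<Rightarrow> complex \<Rightarrow> complex" where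
  "partial_z f z w = deriv (\<lambda>\<zeta>. f (\<zeta>, w)) z"

definition partial_w :: "(complex \<times> complex \<Rightarrow> complex) \<Rightarrow> complex \<Rightarrow> complex \<Rightarrow> complex" where
  "partial_w f z w = deriv (\<lambda>\<zeta>. f (z, \<zeta>)) w"

definition everywhere_inf_extremal :: "(complex \<times> complex \<Rightarrow> complex) \<Rightarrow> bool" where
  "everywhere_inf_extremal f \<longleftrightarrow>
     (\<forall>z\<in>unit_disk. \<forall>w\<in>unit_disk.
        (1 - (cmod z)\<^sup>2) * cmod (partial_z f z w) + (1 - (cmod w)\<^sup>2) * cmod (partial_w f z w)
          = 1 - (cmod (f (z, w)))\<^sup>2)"

definition disk_automorphism :: "(complex \<Rightarrow> complex) \<Rightarrow> bool" where
  "disk_automorphism \<phi> \<longleftrightarrow>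
     \<phi> holomorphic_on unit_disk \<and> bij_betw \<phi> unit_disk unit_disk \<and>
     inv_into unit_disk \<phi> holomorphic_on unit_disk"

end

theory Submission
  imports Defs
begin

text \<open>
  Write \<open>M a z = (z + a) / (1 + cnj a * z)\<close>. Extremality at \<open>(0, w)\<close> is equality in the
  Schwarz--Pick inequality at the origin for \<open>\<zeta> \<mapsto> f (\<zeta>, M w (b \<zeta>))\<close>, for a suitable unimodular
  \<open>b\<close>; hence \<open>f (\<zeta>, M w (b \<zeta>)) = M (f (0, w)) (c \<zeta>)\<close> with \<open>c\<close> unimodular. Let \<open>F\<close> be the continuous
  extension and let \<open>w\<close> tend to a point \<open>\<sigma>\<close> of the unit circle, in such a way that \<open>b\<close> and \<open>c\<close>
  converge. The graphs of \<open>\<zeta> \<mapsto> M w (b \<zeta>)\<close> degenerate to the union of the disks \<open>w = \<sigma>\<close> and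
  \<open>z = - \<sigma> / b\<close>. Along the first, \<open>F (z, \<sigma>) = M (F (0, \<sigma>)) (c z)\<close>, so this slice is constant if
  \<open>|F (0, \<sigma>)| = 1\<close> and maps the closed disk onto itself otherwise. In the second case only, it takes
  the value \<open>- F (0, \<sigma>)\<close>, so both cases are closed conditions on \<open>\<sigma>\<close> and, the circle being
  connected, only one of them occurs. On the second disk, the point with \<open>w = 0\<close> shows that
  \<open>|F (0, \<sigma>)| < 1\<close> forces \<open>|F (\<tau>, 0)| = 1\<close> for some unimodular \<open>\<tau>\<close>. So for one of the two variables
  all slices with that variable fixed on the circle are constant. By the maximum principle \<open>F\<close>
  depends on that variable only, and the formula on a graph through \<open>(0, 0)\<close> shows that it is an
  automorphism.
\<close>

section \<open>Moebius maps and equality in the Schwarz--Pick inequality\<close>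

abbreviation Moebius_translation :: "complex \<Rightarrow> complex \<Rightarrow> complex" where
  "Moebius_translation a \<equiv> Moebius_function 0 (- a)"

lemma Moebius_translation_eq: "Moebius_translation a z = (z + a) / (1 + cnj a * z)"
  by (simp add: Moebius_function_simple)

lemma one_plus_cnj_mult_nonzero:
  assumes "cmod a * cmod z < 1"
  shows "1 + cnj a * z \<noteq> 0"
proof
  assume "1 + cnj a * z = 0"
  then have "cmod (cnj a * z) = cmod (- 1)"
    by (metis add_eq_0_iff)
  with assms show False
    by (simp add: norm_mult)
qed

lemma tendsto_Moebius_translation:
  assumes "(a \<longlongrightarrow> a') G" "(z \<longlongrightarrow> z') G" "1 + cnj a' * z' \<noteq> 0"
  shows "((\<lambda>n. Moebius_translation (a n) (z n)) \<longlongrightarrow> Moebius_translation a' z') G"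
  unfolding Moebius_translation_eq by (intro tendsto_intros assms)

lemma Moebius_translation_unimodular:
  assumes "cmod a = 1" "1 + cnj a * z \<noteq> 0"
  shows "Moebius_translation a z = a"
proof -
  have "a * cnj a = 1"
    using complex_norm_square[of a] assms(1) by simp
  then have "z + a = a * (1 + cnj a * z)"
    by (simp add: distrib_left flip: mult.assoc)
  then show ?thesis
    using assms(2) by (simp add: Moebius_translation_eq)
qed

lemma norm_Moebius_translation_eq_1:
  assumes "cmod a < 1" "cmod z = 1"
  shows "cmod (Moebius_translation a z) = 1"
proof -
  have "z * cnj z = 1"
    using complex_norm_square[of z] assms(2) by simp
  then have "z + a = z * cnj (1 + cnj a * z)"
    by (simp add: distrib_left mult.left_commute)
  then have "cmod (z + a) = cmod (1 + cnj a * z)"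
    by (metis assms(2) complex_mod_cnj mult_1 norm_mult)
  then show ?thesis
    using one_plus_cnj_mult_nonzero[of a z] assms by (simp add: Moebius_translation_eq norm_divide)
qed

lemma has_field_derivative_Moebius_function:
  assumes "1 - cnj a * z \<noteq> 0"
  shows "(Moebius_function 0 a has_field_derivative
    of_real (1 - (cmod a)\<^sup>2) / (1 - cnj a * z)\<^sup>2) (at z)"
proof -
  have "((\<lambda>z. (z - a) / (1 - cnj a * z)) has_field_derivative
      (1 - a * cnj a) / (1 - cnj a * z)\<^sup>2) (at z)"
    using assms by (auto intro!: derivative_eq_intros simp: power2_eq_square algebra_simps)
  then show ?thesis
    by (simp add: Moebius_function_simple[abs_def] complex_norm_square del: of_real_power)
qed

lemma disk_automorphismI:
  assumes "g holomorphic_on unit_disk" "h holomorphic_on unit_disk"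
    and "g ` unit_disk \<subseteq> unit_disk" "h ` unit_disk \<subseteq> unit_disk"
    and "\<And>z. z \<in> unit_disk \<Longrightarrow> h (g z) = z" and gh: "\<And>z. z \<in> unit_disk \<Longrightarrow> g (h z) = z"
  shows "disk_automorphism g"
proof -
  have bij: "bij_betw g unit_disk unit_disk"
    using assms by (intro bij_betw_byWitness[where f' = h]) auto
  have "h z = inv_into unit_disk g z" if "z \<in> unit_disk" for z
    using bij gh[OF that] assms(4) that by (metis bij_betw_def image_subset_iff inv_into_f_eq)
  then have "inv_into unit_disk g holomorphic_on unit_disk"
    using holomorphic_transform[OF assms(2)] by blast
  with bij assms(1) show ?thesis
    by (simp add: disk_automorphism_def)
qed

lemma Moebius_translation_rotation_in_unit_disk:
  assumes "cmod a < 1" "cmod c = 1" "z \<in> unit_disk"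
  shows "Moebius_translation a (c * z) \<in> unit_disk"
  using assms Moebius_function_norm_lt_1[of "- a" "c * z"] by (simp add: norm_mult)

lemma holomorphic_on_Moebius_translation_rotation:
  assumes "cmod a < 1" "cmod c = 1"
  shows "(\<lambda>z. Moebius_translation a (c * z)) holomorphic_on unit_disk"
proof -
  have "(Moebius_translation a \<circ> (*) c) holomorphic_on unit_disk"
    using assms by (intro holomorphic_on_compose_gen[OF _ Moebius_function_holomorphic])
      (auto intro!: holomorphic_intros simp: norm_mult)
  then show ?thesis
    by (simp add: o_def)
qed

lemma disk_automorphism_Moebius_translation_rotation:
  assumes a: "cmod a < 1" and c: "cmod c = 1"
  shows "disk_automorphism (\<lambda>z. Moebius_translation a (c * z))"
proof (rule disk_automorphismI[where h = "\<lambda>z. Moebius_function 0 a z / c"])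
  have "c \<noteq> 0"
    using c by auto
  then show "(\<lambda>z. Moebius_function 0 a z / c) holomorphic_on unit_disk"
    by (intro holomorphic_intros Moebius_function_holomorphic a)
  show "(\<lambda>z. Moebius_function 0 a z / c) ` unit_disk \<subseteq> unit_disk"
    using Moebius_function_norm_lt_1[OF a] c by (auto simp: norm_divide)
  show "Moebius_function 0 a (Moebius_translation a (c * z)) / c = z" if "z \<in> unit_disk" for z
    using Moebius_function_compose[of a "- a" "c * z"] a c \<open>c \<noteq> 0\<close> that by (simp add: norm_mult)
  show "Moebius_translation a (c * (Moebius_function 0 a z / c)) = z" if "z \<in> unit_disk" for z
    using Moebius_function_compose[of "- a" a z] a \<open>c \<noteq> 0\<close> that by simp
qed (use assms in \<open>auto simp del: mem_ball_0
      intro: Moebius_translation_rotation_in_unit_disk holomorphic_on_Moebius_translation_rotation\<close>)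

lemma has_field_derivative_Moebius_translation_rotation:
  "((\<lambda>z. Moebius_translation a (c * z)) has_field_derivative of_real (1 - (cmod a)\<^sup>2) * c) (at 0)"
  using DERIV_chain2[OF has_field_derivative_Moebius_function DERIV_cmult_Id, of "- a" c 0 UNIV]
  by simp

lemma Schwarz_Pick_equality:
  assumes hol: "g holomorphic_on unit_disk" and maps: "g ` unit_disk \<subseteq> unit_disk"
    and deriv: "cmod (deriv g 0) = 1 - (cmod (g 0))\<^sup>2"
  obtains c where "cmod c = 1" "\<And>z. z \<in> unit_disk \<Longrightarrow> g z = Moebius_translation (g 0) (c * z)"
proof -
  define a where "a = g 0"
  define d where "d = 1 - (cmod a)\<^sup>2"
  define h where "h = (\<lambda>z. Moebius_function 0 a (g z))"
  have a: "cmod a < 1"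
    using maps by (force simp: a_def)
  then have d: "d > 0"
    by (simp add: d_def abs_square_less_1)
  have d_eq: "1 - cnj a * a = of_real d"
    by (simp add: d_def complex_norm_square mult.commute del: of_real_power)
  have h_hol: "h holomorphic_on unit_disk"
    using holomorphic_on_compose_gen[OF hol Moebius_function_holomorphic[OF a] maps]
    by (simp add: h_def o_def)
  have h_maps: "cmod (h z) < 1" if "cmod z < 1" for z
    using Moebius_function_norm_lt_1[OF a] maps that by (simp add: h_def image_subset_iff)
  have "(Moebius_function 0 a has_field_derivative of_real d / (of_real d)\<^sup>2) (at (g 0))"
    using has_field_derivative_Moebius_function[of a a] d unfolding d_eq d_def[symmetric]
    by (simp add: a_def)
  moreover have "(g has_field_derivative deriv g 0) (at 0)"
    using hol by (intro holomorphic_derivI[OF _ open_ball]) auto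
  ultimately have "(h has_field_derivative of_real d / (of_real d)\<^sup>2 * deriv g 0) (at 0)"
    unfolding h_def by (rule DERIV_chain2)
  then have "deriv h 0 = of_real d / (of_real d)\<^sup>2 * deriv g 0"
    by (rule DERIV_imp_deriv)
  then have "cmod (deriv h 0) = 1"
    using d deriv
    by (simp add: norm_mult norm_divide power2_eq_square[of "of_real d"] flip: a_def d_def)
  then obtain c where c: "cmod c = 1" and h_eq: "\<And>z. cmod z < 1 \<Longrightarrow> h z = c * z"
    using Schwarz_Lemma(3)[OF h_hol _ h_maps, of 0]
    by (auto simp: h_def a_def Moebius_function_eq_zero)
  have "g z = Moebius_translation a (c * z)" if "z \<in> unit_disk" for z
    using Moebius_function_compose[of "- a" a "g z"] h_eq[of z] a maps that
    by (simp add: h_def image_subset_iff)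
  with c show thesis
    unfolding a_def by (rule that)
qed

section \<open>Holomorphic functions of two variables\<close>

lemma holomorphic2_on_has_derivative:
  assumes "f holomorphic2_on S" "open S" "(z, w) \<in> S"
  shows "(f has_derivative (\<lambda>h. partial_z f z w * fst h + partial_w f z w * snd h)) (at (z, w))"
proof -
  obtain a b where ab: "(f has_derivative (\<lambda>h. a * fst h + b * snd h)) (at (z, w))"
    using assms at_within_open[of "(z, w)" S] unfolding holomorphic2_on_def by force
  have "((\<lambda>\<zeta>. (\<zeta>, w)) has_derivative (\<lambda>h. (h, 0))) (at z)"
    by (auto intro!: derivative_eq_intros)
  from has_derivative_compose[OF this ab] have "partial_z f z w = a"
    by (simp add: partial_z_def DERIV_imp_deriv has_field_derivative_def)
  moreover have "((\<lambda>\<zeta>. (z, \<zeta>)) has_derivative (\<lambda>h. (0, h))) (at w)"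
    by (auto intro!: derivative_eq_intros)
  from has_derivative_compose[OF this ab] have "partial_w f z w = b"
    by (simp add: partial_w_def DERIV_imp_deriv has_field_derivative_def)
  ultimately show ?thesis
    using ab by simp
qed

lemma holomorphic2_on_chain_rule:
  assumes "f holomorphic2_on S" "open S" "(g \<zeta>, h \<zeta>) \<in> S"
    and g: "(g has_field_derivative g') (at \<zeta> within T)"
    and h: "(h has_field_derivative h') (at \<zeta> within T)"
  shows "((\<lambda>\<zeta>. f (g \<zeta>, h \<zeta>)) has_field_derivative
    partial_z f (g \<zeta>) (h \<zeta>) * g' + partial_w f (g \<zeta>) (h \<zeta>) * h') (at \<zeta> within T)"
proof -
  have "((\<lambda>\<zeta>. (g \<zeta>, h \<zeta>)) has_derivative (\<lambda>x. (g' * x, h' * x))) (at \<zeta> within T)"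
    using g h unfolding has_field_derivative_def by (rule has_derivative_Pair)
  from has_derivative_compose[OF this holomorphic2_on_has_derivative[OF assms(1-3)]]
  show ?thesis
    by (rule has_derivative_imp_has_field_derivative) (simp add: distrib_left mult_ac)
qed

lemma holomorphic_on_compose_holomorphic2:
  assumes "f holomorphic2_on S" "open S"
    and "g holomorphic_on T" "h holomorphic_on T" "\<And>\<zeta>. \<zeta> \<in> T \<Longrightarrow> (g \<zeta>, h \<zeta>) \<in> S"
  shows "(\<lambda>\<zeta>. f (g \<zeta>, h \<zeta>)) holomorphic_on T"
  unfolding holomorphic_on_def
proof
  fix \<zeta> assume \<zeta>: "\<zeta> \<in> T"
  then obtain g' h' where "(g has_field_derivative g') (at \<zeta> within T)"
    "(h has_field_derivative h') (at \<zeta> within T)"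
    using assms(3,4) unfolding holomorphic_on_def field_differentiable_def by metis
  from holomorphic2_on_chain_rule[OF assms(1,2) assms(5)[OF \<zeta>] this]
  show "(\<lambda>\<zeta>. f (g \<zeta>, h \<zeta>)) field_differentiable at \<zeta> within T"
    unfolding field_differentiable_def ..
qed

lemma holomorphic2_on_cong:
  assumes "\<And>p. p \<in> S \<Longrightarrow> f p = g p"
  shows "f holomorphic2_on S \<longleftrightarrow> g holomorphic2_on S"
proof -
  have "(f has_derivative D) (at p within S) \<longleftrightarrow> (g has_derivative D) (at p within S)"
    if "p \<in> S" for p D
    using has_derivative_transform[OF that] assms by metis
  then show ?thesis
    by (simp add: holomorphic2_on_def)
qed

lemma holomorphic2_on_swap:
  assumes "f holomorphic2_on S"
  shows "(f \<circ> prod.swap) holomorphic2_on prod.swap ` S"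
  unfolding holomorphic2_on_def
proof
  fix p assume "p \<in> prod.swap ` S"
  then obtain a b where
    "(f has_derivative (\<lambda>h. a * fst h + b * snd h)) (at (prod.swap p) within S)"
    using assms unfolding holomorphic2_on_def by fastforce
  then have outer: "(f has_derivative (\<lambda>h. a * fst h + b * snd h))
      (at (prod.swap p) within prod.swap ` prod.swap ` S)"
    by (simp add: image_image)
  have "(prod.swap has_derivative prod.swap) (at p within prod.swap ` S)"
    unfolding prod.swap_def by (auto intro!: derivative_eq_intros)
  from has_derivative_in_compose[OF this outer]
  have "((f \<circ> prod.swap) has_derivative (\<lambda>h. b * fst h + a * snd h))
      (at p within prod.swap ` S)"
    by (simp add: o_def add.commute)
  then show "\<exists>a b. ((f \<circ> prod.swap) has_derivative (\<lambda>h. a * fst h + b * snd h))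
      (at p within prod.swap ` S)"
    by blast
qed

lemma everywhere_inf_extremal_cong:
  assumes eq: "\<And>p. p \<in> bidisk \<Longrightarrow> f p = g p"
  shows "everywhere_inf_extremal f \<longleftrightarrow> everywhere_inf_extremal g"
proof -
  have "partial_z f z w = partial_z g z w \<and> partial_w f z w = partial_w g z w"
    if z: "z \<in> unit_disk" and w: "w \<in> unit_disk" for z w
  proof -
    have "\<forall>\<^sub>F \<zeta> in nhds z. f (\<zeta>, w) = g (\<zeta>, w)" "\<forall>\<^sub>F \<zeta> in nhds w. f (z, \<zeta>) = g (z, \<zeta>)"
      using eventually_nhds_in_open[OF open_ball z] eventually_nhds_in_open[OF open_ball w]
      by (auto elim!: eventually_mono simp del: mem_ball_0 intro!: eq z w)
    then show ?thesis
      unfolding partial_z_def partial_w_def by (auto intro!: deriv_cong_ev)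
  qed
  then show ?thesis
    using eq by (simp add: everywhere_inf_extremal_def)
qed

lemma everywhere_inf_extremal_swap:
  assumes "everywhere_inf_extremal f"
  shows "everywhere_inf_extremal (f \<circ> prod.swap)"
  unfolding everywhere_inf_extremal_def
proof (intro ballI)
  fix z w assume "z \<in> unit_disk" "w \<in> unit_disk"
  then have "(1 - (cmod w)\<^sup>2) * cmod (partial_z f w z) + (1 - (cmod z)\<^sup>2) * cmod (partial_w f w z)
      = 1 - (cmod (f (w, z)))\<^sup>2"
    using assms unfolding everywhere_inf_extremal_def by blast
  then show "(1 - (cmod z)\<^sup>2) * cmod (partial_z (f \<circ> prod.swap) z w)
      + (1 - (cmod w)\<^sup>2) * cmod (partial_w (f \<circ> prod.swap) z w)
      = 1 - (cmod ((f \<circ> prod.swap) (z, w)))\<^sup>2"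
    by (simp add: partial_z_def partial_w_def add.commute)
qed

lemma unimodular_align_norm:
  fixes x y :: complex
  obtains b where "cmod b = 1" "cmod (x + b * y) = cmod x + cmod y"
proof (cases "x = 0 \<or> y = 0")
  case True
  then show ?thesis
    using that[of 1] by auto
next
  case False
  define b where "b = sgn x / sgn y"
  have b: "cmod b = 1"
    using False by (simp add: b_def norm_divide norm_sgn)
  moreover have "b * y = cmod y *\<^sub>R sgn x"
    using False by (simp add: b_def sgn_div_norm scaleR_conv_of_real field_simps)
  then have "cmod x *\<^sub>R (b * y) = cmod (b * y) *\<^sub>R x"
    using False b by (simp add: norm_mult sgn_div_norm)
  then have "cmod (x + b * y) = cmod x + cmod (b * y)"
    by (simp add: norm_triangle_eq)
  ultimately show ?thesis
    using that by (simp add: norm_mult)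
qed

definition Moebius_on_graph ::
    "(complex \<times> complex \<Rightarrow> complex) \<Rightarrow> complex \<Rightarrow> complex \<Rightarrow> complex \<Rightarrow> complex \<Rightarrow> bool" where
  "Moebius_on_graph f z w b c \<longleftrightarrow> cmod b = 1 \<and> cmod c = 1 \<and>
     (\<forall>\<zeta>\<in>unit_disk. f (Moebius_translation z \<zeta>, Moebius_translation w (b * \<zeta>))
        = Moebius_translation (f (z, w)) (c * \<zeta>))"

lemma deriv_on_Moebius_graph:
  assumes "f holomorphic2_on bidisk" "z \<in> unit_disk" "w \<in> unit_disk"
  shows "deriv (\<lambda>\<zeta>. f (Moebius_translation z \<zeta>, Moebius_translation w (b * \<zeta>))) 0
    = of_real (1 - (cmod z)\<^sup>2) * partial_z f z w + b * (of_real (1 - (cmod w)\<^sup>2) * partial_w f z w)"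
  using assms holomorphic2_on_chain_rule[OF assms(1) _ _
      has_field_derivative_Moebius_translation_rotation[of z 1]
      has_field_derivative_Moebius_translation_rotation[of w b]]
  by (simp add: open_Times DERIV_imp_deriv Moebius_function_of_zero mult_ac)

lemma inf_extremal_imp_Moebius_on_graph:
  assumes hol: "f holomorphic2_on bidisk" and maps: "f ` bidisk \<subseteq> unit_disk"
    and z: "z \<in> unit_disk" and w: "w \<in> unit_disk"
    and extremal: "(1 - (cmod z)\<^sup>2) * cmod (partial_z f z w)
      + (1 - (cmod w)\<^sup>2) * cmod (partial_w f z w) = 1 - (cmod (f (z, w)))\<^sup>2"
  shows "\<exists>b c. Moebius_on_graph f z w b c"
proof -
  define x y where "x = of_real (1 - (cmod z)\<^sup>2) * partial_z f z w"
    and "y = of_real (1 - (cmod w)\<^sup>2) * partial_w f z w"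
  obtain b where b: "cmod b = 1" and align: "cmod (x + b * y) = cmod x + cmod y"
    using unimodular_align_norm .
  define k where
    "k \<zeta> = f (Moebius_translation z (1 * \<zeta>), Moebius_translation w (b * \<zeta>))" for \<zeta>
  have in_bidisk: "(Moebius_translation z (1 * \<zeta>), Moebius_translation w (b * \<zeta>)) \<in> bidisk"
    if "\<zeta> \<in> unit_disk" for \<zeta>
    using Moebius_translation_rotation_in_unit_disk[OF _ _ that] z w b
    by (metis mem_Sigma_iff mem_ball_0 norm_one)
  have k_0: "k 0 = f (z, w)"
    by (simp add: k_def Moebius_function_of_zero)
  have k_hol: "k holomorphic_on unit_disk"
    unfolding k_def using z w b in_bidisk
    by (intro holomorphic_on_compose_holomorphic2[OF hol] open_Times
        holomorphic_on_Moebius_translation_rotation) auto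
  have k_maps: "k ` unit_disk \<subseteq> unit_disk"
    using in_bidisk maps unfolding k_def by blast
  have "deriv k 0 = x + b * y"
    unfolding k_def mult_1 x_def y_def using hol z w by (rule deriv_on_Moebius_graph)
  moreover have "cmod x + cmod y = 1 - (cmod (f (z, w)))\<^sup>2"
    using z w extremal unfolding x_def y_def norm_mult norm_of_real
    by (simp add: abs_square_le_1)
  ultimately have "cmod (deriv k 0) = 1 - (cmod (k 0))\<^sup>2"
    by (simp add: align k_0)
  from Schwarz_Pick_equality[OF k_hol k_maps this] obtain c where "cmod c = 1"
    "\<And>\<zeta>. \<zeta> \<in> unit_disk \<Longrightarrow> k \<zeta> = Moebius_translation (k 0) (c * \<zeta>)"
    by blast
  with b have "Moebius_on_graph f z w b c"
    by (simp add: Moebius_on_graph_def k_0) (simp add: k_def)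
  then show ?thesis
    by blast
qed

section \<open>Boundary values of an extremal function\<close>

locale continuous_extremal =
  fixes F :: "complex \<times> complex \<Rightarrow> complex"
  assumes hol: "F holomorphic2_on bidisk"
    and maps: "F ` bidisk \<subseteq> unit_disk"
    and extremal: "everywhere_inf_extremal F"
    and cont: "continuous_on (cball 0 1 \<times> cball 0 1) F"
begin

lemma continuous_extremal_swap: "continuous_extremal (F \<circ> prod.swap)"
proof
  show "(F \<circ> prod.swap) holomorphic2_on bidisk"
    using holomorphic2_on_swap[OF hol] by (simp add: product_swap)
  show "(F \<circ> prod.swap) ` bidisk \<subseteq> unit_disk"
    using maps by auto
  show "everywhere_inf_extremal (F \<circ> prod.swap)"
    using extremal by (rule everywhere_inf_extremal_swap)
  show "continuous_on (cball 0 1 \<times> cball 0 1) (F \<circ> prod.swap)"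
    by (intro continuous_on_compose continuous_on_swap) (simp add: product_swap cont)
qed

lemma continuous_on_slices:
  assumes "c \<in> cball 0 1"
  shows "continuous_on (cball 0 1) (\<lambda>z. F (z, c))" "continuous_on (cball 0 1) (\<lambda>w. F (c, w))"
proof -
  show "continuous_on (cball 0 1) (\<lambda>z. F (z, c))"
    using assms by (intro continuous_on_compose2[OF cont] continuous_intros) auto
  show "continuous_on (cball 0 1) (\<lambda>w. F (c, w))"
    using assms by (intro continuous_on_compose2[OF cont] continuous_intros) auto
qed

lemma norm_F_le_1:
  assumes "z \<in> cball 0 1" "w \<in> cball 0 1"
  shows "cmod (F (z, w)) \<le> 1"
proof -
  have "F ` closure bidisk \<subseteq> cball 0 1"
    using cont maps by (intro image_closure_subset)
      (auto simp: closure_Times image_subset_iff intro: less_imp_le)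
  then show ?thesis
    using assms by (force simp: closure_Times)
qed

lemma tendsto_F:
  assumes "(z \<longlongrightarrow> z') G" "(w \<longlongrightarrow> w') G" "z' \<in> cball 0 1" "w' \<in> cball 0 1"
    and "\<And>n. z n \<in> cball 0 1" "\<And>n. w n \<in> cball 0 1"
  shows "((\<lambda>n. F (z n, w n)) \<longlongrightarrow> F (z', w')) G"
  using assms(3-) by (intro continuous_on_tendsto_compose[OF cont tendsto_Pair[OF assms(1,2)]]) auto

lemma exists_Moebius_on_graph:
  assumes "w \<in> unit_disk"
  shows "\<exists>b c. Moebius_on_graph F 0 w b c"
proof -
  have "0 \<in> unit_disk"
    by simp
  from extremal[unfolded everywhere_inf_extremal_def, rule_format, OF this assms]
  show ?thesis
    using assms by (intro inf_extremal_imp_Moebius_on_graph[OF hol maps]) simp_all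
qed

lemma Moebius_on_graph_0D:
  assumes "Moebius_on_graph F 0 w b c" "\<zeta> \<in> unit_disk"
  shows "F (\<zeta>, Moebius_translation w (b * \<zeta>)) = Moebius_translation (F (0, w)) (c * \<zeta>)"
  using assms by (simp add: Moebius_on_graph_def Moebius_function_simple)

lemma Moebius_on_graphs_near_boundary:
  assumes \<sigma>: "cmod \<sigma> = 1"
  obtains w b c :: "nat \<Rightarrow> complex" and b' c'
  where "\<And>n. w n \<in> unit_disk" "\<And>n. Moebius_on_graph F 0 (w n) (b n) (c n)"
    and "w \<longlonglongrightarrow> \<sigma>" "b \<longlonglongrightarrow> b'" "c \<longlonglongrightarrow> c'" "cmod b' = 1" "cmod c' = 1"
    and "(\<lambda>n. F (0, w n)) \<longlonglongrightarrow> F (0, \<sigma>)"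
proof -
  have "\<sigma> \<in> closure unit_disk"
    using \<sigma> by simp
  then obtain w where w: "\<And>n. w n \<in> unit_disk" and w_lim: "w \<longlonglongrightarrow> \<sigma>"
    unfolding closure_sequential by blast
  obtain b c where graph: "\<And>n. Moebius_on_graph F 0 (w n) (b n) (c n)"
    using exists_Moebius_on_graph[OF w] by metis
  have "seq_compact (sphere (0::complex) 1 \<times> sphere (0::complex) 1)"
    by (intro compact_imp_seq_compact compact_Times compact_sphere)
  moreover have "\<forall>n. (b n, c n) \<in> sphere 0 1 \<times> sphere 0 1"
    using graph by (simp add: Moebius_on_graph_def)
  ultimately obtain p r where p: "p \<in> sphere 0 1 \<times> sphere 0 1"
    and r: "strict_mono r" and lim: "((\<lambda>n. (b n, c n)) \<circ> r) \<longlonglongrightarrow> p"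
    by (rule seq_compactE)
  have subseq_lim: "(w \<circ> r) \<longlonglongrightarrow> \<sigma>"
    using w_lim r by (rule LIMSEQ_subseq_LIMSEQ)
  show thesis
  proof (rule that[of "w \<circ> r" "b \<circ> r" "c \<circ> r" "fst p" "snd p"])
    show "(b \<circ> r) \<longlonglongrightarrow> fst p" "(c \<circ> r) \<longlonglongrightarrow> snd p"
      using tendsto_fst[OF lim] tendsto_snd[OF lim] by (simp_all add: o_def)
    show "(\<lambda>n. F (0, (w \<circ> r) n)) \<longlonglongrightarrow> F (0, \<sigma>)"
      using \<sigma> w by (intro tendsto_F subseq_lim tendsto_const) (auto simp: less_imp_le)
  qed (use w graph subseq_lim p in auto)
qed

lemma boundary_slice_Moebius:
  assumes \<sigma>: "cmod \<sigma> = 1"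
  obtains c where "cmod c = 1"
    "\<And>z. z \<in> unit_disk \<Longrightarrow> F (z, \<sigma>) = Moebius_translation (F (0, \<sigma>)) (c * z)"
proof -
  obtain w b c b' c' where w: "\<And>n. w n \<in> unit_disk"
    and graph: "\<And>n. Moebius_on_graph F 0 (w n) (b n) (c n)"
    and lim: "w \<longlonglongrightarrow> \<sigma>" "b \<longlonglongrightarrow> b'" "c \<longlonglongrightarrow> c'" and unimodular: "cmod b' = 1" "cmod c' = 1"
    and center_lim: "(\<lambda>n. F (0, w n)) \<longlonglongrightarrow> F (0, \<sigma>)"
    using Moebius_on_graphs_near_boundary[OF \<sigma>] by blast
  have "F (z, \<sigma>) = Moebius_translation (F (0, \<sigma>)) (c' * z)" if z: "z \<in> unit_disk" for z
  proof (rule LIMSEQ_unique)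
    have nonzero: "1 + cnj \<sigma> * (b' * z) \<noteq> 0"
      using \<sigma> unimodular z by (intro one_plus_cnj_mult_nonzero) (simp add: norm_mult)
    then have "(\<lambda>n. Moebius_translation (w n) (b n * z)) \<longlonglongrightarrow> Moebius_translation \<sigma> (b' * z)"
      by (intro tendsto_Moebius_translation tendsto_intros lim)
    moreover have "Moebius_translation \<sigma> (b' * z) = \<sigma>"
      using \<sigma> nonzero by (rule Moebius_translation_unimodular)
    moreover have "Moebius_translation (w n) (b n * z) \<in> cball 0 1" for n
      using Moebius_translation_rotation_in_unit_disk[OF _ _ z, of "w n" "b n"] w graph[of n]
      by (simp add: Moebius_on_graph_def less_imp_le)
    ultimately show "(\<lambda>n. Moebius_translation (F (0, w n)) (c n * z)) \<longlonglongrightarrow> F (z, \<sigma>)"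
      using \<sigma> z unfolding Moebius_on_graph_0D[OF graph z, symmetric]
      by (intro tendsto_F) auto
    have "1 + cnj (F (0, \<sigma>)) * (c' * z) \<noteq> 0"
      using norm_F_le_1[of 0 \<sigma>] \<sigma> unimodular z
      by (intro one_plus_cnj_mult_nonzero le_less_trans[OF mult_left_le_one_le])
        (simp_all add: norm_mult)
    then show "(\<lambda>n. Moebius_translation (F (0, w n)) (c n * z))
        \<longlonglongrightarrow> Moebius_translation (F (0, \<sigma>)) (c' * z)"
      by (intro tendsto_Moebius_translation tendsto_intros lim center_lim)
  qed
  with unimodular(2) show thesis
    by (rule that)
qed

lemma exists_unimodular_boundary_value:
  assumes \<sigma>: "cmod \<sigma> = 1" and less: "cmod (F (0, \<sigma>)) < 1"
  obtains \<tau> where "cmod \<tau> = 1" "cmod (F (\<tau>, 0)) = 1"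
proof -
  obtain w b c b' c' where w: "\<And>n. w n \<in> unit_disk"
    and graph: "\<And>n. Moebius_on_graph F 0 (w n) (b n) (c n)"
    and lim: "w \<longlonglongrightarrow> \<sigma>" "b \<longlonglongrightarrow> b'" "c \<longlonglongrightarrow> c'" and unimodular: "cmod b' = 1" "cmod c' = 1"
    and center_lim: "(\<lambda>n. F (0, w n)) \<longlonglongrightarrow> F (0, \<sigma>)"
    using Moebius_on_graphs_near_boundary[OF \<sigma>] by blast
  define \<tau> where "\<tau> = - \<sigma> / b'"
  define \<zeta> where "\<zeta> n = - w n / b n" for n
  have \<tau>: "cmod \<tau> = 1"
    using \<sigma> unimodular by (simp add: \<tau>_def norm_divide)
  have \<zeta>_lim: "\<zeta> \<longlonglongrightarrow> \<tau>"
    using unimodular unfolding \<zeta>_def \<tau>_def by (intro tendsto_intros lim) auto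
  have b: "cmod (b n) = 1" for n
    using graph[of n] by (simp add: Moebius_on_graph_def)
  then have \<zeta>: "\<zeta> n \<in> unit_disk" for n
    using w by (simp add: \<zeta>_def norm_divide)
  have "b n \<noteq> 0" for n
    using b[of n] by auto
  then have "Moebius_translation (w n) (b n * \<zeta> n) = 0" for n
    by (simp add: \<zeta>_def Moebius_function_eq_zero)
  with Moebius_on_graph_0D[OF graph \<zeta>]
  have graph_0: "F (\<zeta> n, 0) = Moebius_translation (F (0, w n)) (c n * \<zeta> n)" for n
    by metis
  have "F (\<tau>, 0) = Moebius_translation (F (0, \<sigma>)) (c' * \<tau>)"
  proof (rule LIMSEQ_unique)
    show "(\<lambda>n. F (\<zeta> n, 0)) \<longlonglongrightarrow> F (\<tau>, 0)"
      using \<zeta> \<tau> by (intro tendsto_F \<zeta>_lim) (auto simp: less_imp_le)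
    show "(\<lambda>n. F (\<zeta> n, 0)) \<longlonglongrightarrow> Moebius_translation (F (0, \<sigma>)) (c' * \<tau>)"
      unfolding graph_0 using less unimodular \<tau>
      by (intro tendsto_Moebius_translation tendsto_mult \<zeta>_lim lim center_lim
          one_plus_cnj_mult_nonzero) (simp_all add: norm_mult)
  qed
  then have "cmod (F (\<tau>, 0)) = 1"
    using less unimodular \<tau> by (simp add: norm_Moebius_translation_eq_1 norm_mult)
  with \<tau> show thesis
    by (rule that)
qed

lemma boundary_slice_constant:
  assumes \<sigma>: "cmod \<sigma> = 1" and unimodular: "cmod (F (0, \<sigma>)) = 1" and z: "z \<in> cball 0 1"
  shows "F (z, \<sigma>) = F (0, \<sigma>)"
proof (rule continuous_constant_on_closure[where S = unit_disk and f = "\<lambda>z. F (z, \<sigma>)"])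
  obtain c where c: "cmod c = 1"
    "\<And>z. z \<in> unit_disk \<Longrightarrow> F (z, \<sigma>) = Moebius_translation (F (0, \<sigma>)) (c * z)"
    using boundary_slice_Moebius[OF \<sigma>] by blast
  show "F (z, \<sigma>) = F (0, \<sigma>)" if "z \<in> unit_disk" for z
    unfolding c(2)[OF that] using c(1) unimodular that
    by (intro Moebius_translation_unimodular one_plus_cnj_mult_nonzero) (simp_all add: norm_mult)
  show "continuous_on (closure unit_disk) (\<lambda>z. F (z, \<sigma>))"
    using continuous_on_slices(1)[of \<sigma>] \<sigma> by simp
  show "z \<in> closure unit_disk"
    using z by simp
qed

lemma boundary_slice_surj:
  assumes \<sigma>: "cmod \<sigma> = 1" and less: "cmod (F (0, \<sigma>)) < 1"
  shows "cball 0 1 \<subseteq> (\<lambda>z. F (z, \<sigma>)) ` cball 0 1"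
proof -
  obtain c where c: "cmod c = 1"
    "\<And>z. z \<in> unit_disk \<Longrightarrow> F (z, \<sigma>) = Moebius_translation (F (0, \<sigma>)) (c * z)"
    using boundary_slice_Moebius[OF \<sigma>] by blast
  have "unit_disk = (\<lambda>z. Moebius_translation (F (0, \<sigma>)) (c * z)) ` unit_disk"
    using disk_automorphism_Moebius_translation_rotation[OF less c(1)]
    by (simp add: disk_automorphism_def bij_betw_def)
  also have "\<dots> = (\<lambda>z. F (z, \<sigma>)) ` unit_disk"
    by (rule image_cong[OF refl c(2)[symmetric]])
  also have "\<dots> \<subseteq> (\<lambda>z. F (z, \<sigma>)) ` cball 0 1"
    by (intro image_mono ball_subset_cball)
  finally have "closure unit_disk \<subseteq> (\<lambda>z. F (z, \<sigma>)) ` cball 0 1"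
    using continuous_on_slices(1)[of \<sigma>] \<sigma>
    by (intro closure_minimal compact_imp_closed compact_continuous_image) auto
  then show ?thesis
    by simp
qed

lemma boundary_slice_attains_neg_center_iff:
  assumes \<sigma>: "cmod \<sigma> = 1"
  shows "(\<exists>z\<in>cball 0 1. F (z, \<sigma>) = - F (0, \<sigma>)) \<longleftrightarrow> cmod (F (0, \<sigma>)) < 1"
proof (cases "cmod (F (0, \<sigma>)) = 1")
  case True
  then have "F (z, \<sigma>) \<noteq> - F (0, \<sigma>)" if "z \<in> cball 0 1" for z
    unfolding boundary_slice_constant[OF \<sigma> True that] eq_neg_iff_add_eq_0 mult_2[symmetric]
    by auto
  with True show ?thesis
    by (metis less_irrefl)
next
  case False
  then have less: "cmod (F (0, \<sigma>)) < 1"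
    using norm_F_le_1[of 0 \<sigma>] \<sigma> by simp
  then have "- F (0, \<sigma>) \<in> cball 0 1"
    by simp
  then have "- F (0, \<sigma>) \<in> (\<lambda>z. F (z, \<sigma>)) ` cball 0 1"
    by (rule subsetD[OF boundary_slice_surj[OF \<sigma> less]])
  then obtain z where z: "- F (0, \<sigma>) = F (z, \<sigma>)" "z \<in> cball 0 1"
    by (rule imageE)
  then have "\<exists>z\<in>cball 0 1. F (z, \<sigma>) = - F (0, \<sigma>)"
    by (intro bexI[of _ z]) simp_all
  with less show ?thesis
    by blast
qed

lemma boundary_dichotomy:
  "(\<forall>\<sigma>\<in>sphere 0 1. cmod (F (0, \<sigma>)) = 1) \<or> (\<forall>\<sigma>\<in>sphere 0 1. cmod (F (0, \<sigma>)) < 1)"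
proof -
  define A where "A = {\<sigma> \<in> sphere 0 1. cmod (F (0, \<sigma>)) = 1}"
  define B where "B = {\<sigma> \<in> sphere 0 1. cmod (F (0, \<sigma>)) < 1}"
  define P :: "(complex \<times> complex) set" where "P = cball 0 1 \<times> sphere 0 1"
  have "closed A"
    unfolding A_def using continuous_on_subset[OF continuous_on_slices(2)[of 0] sphere_cball]
    by (intro continuous_closed_preimage_constant continuous_intros) auto
  have "compact P"
    unfolding P_def by (intro compact_Times compact_cball compact_sphere)
  moreover have "continuous_on P (\<lambda>p. F p + F (0, snd p))"
    by (intro continuous_intros continuous_on_compose2[OF cont]) (auto simp: P_def)
  then have "closedin (top_of_set P) {p \<in> P. F p + F (0, snd p) = 0}"
    by (rule continuous_closedin_preimage_constant)
  ultimately have "compact {p \<in> P. F p + F (0, snd p) = 0}"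
    by (rule closedin_compact)
  then have "closed (snd ` {p \<in> P. F p + F (0, snd p) = 0})"
    by (intro compact_imp_closed compact_continuous_image continuous_intros)
  also have "snd ` {p \<in> P. F p + F (0, snd p) = 0}
      = {\<sigma> \<in> sphere 0 1. \<exists>z\<in>cball 0 1. F (z, \<sigma>) = - F (0, \<sigma>)}"
    by (force simp: P_def eq_neg_iff_add_eq_0)
  also have "\<dots> = B"
    unfolding B_def by (intro Collect_cong conj_cong refl boundary_slice_attains_neg_center_iff) simp
  finally have "closed B" .
  have "connected (sphere (0::complex) 1)"
    by (simp add: connected_sphere_eq)
  moreover have cover: "sphere 0 1 \<subseteq> A \<union> B"
    using norm_F_le_1[of 0] by (force simp: A_def B_def less_le)
  moreover have "A \<inter> B \<inter> sphere 0 1 = {}"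
    by (auto simp: A_def B_def)
  ultimately have "A \<inter> sphere 0 1 = {} \<or> B \<inter> sphere 0 1 = {}"
    using \<open>closed A\<close> \<open>closed B\<close> by (intro connected_closedD)
  then show ?thesis
    using cover unfolding A_def B_def by blast
qed

lemma boundary_unimodular_imp_depends_on_snd:
  assumes unimodular: "\<forall>\<sigma>\<in>sphere 0 1. cmod (F (0, \<sigma>)) = 1"
    and z: "z \<in> unit_disk" and w: "w \<in> unit_disk"
  shows "F (z, w) = F (0, w)"
proof -
  have hol_slice: "(\<lambda>w. F (z, w)) holomorphic_on unit_disk" if "z \<in> unit_disk" for z
    using that by (intro holomorphic_on_compose_holomorphic2[OF hol open_Times]) auto
  have "cmod (F (z, w) - F (0, w)) \<le> 0"
  proof (rule maximum_modulus_frontier[where S = unit_disk and f = "\<lambda>w. F (z, w) - F (0, w)"])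
    show "(\<lambda>w. F (z, w) - F (0, w)) holomorphic_on interior unit_disk"
      using holomorphic_on_diff[OF hol_slice[OF z] hol_slice[of 0]] by simp
    show "continuous_on (closure unit_disk) (\<lambda>w. F (z, w) - F (0, w))"
      using continuous_on_diff[OF continuous_on_slices(2)[of z] continuous_on_slices(2)[of 0]] z
      by simp
    show "cmod (F (z, \<sigma>) - F (0, \<sigma>)) \<le> 0" if "\<sigma> \<in> frontier unit_disk" for \<sigma>
      using boundary_slice_constant[of \<sigma> z] unimodular that z by simp
  qed (use w in auto)
  then show ?thesis
    by simp
qed

lemma boundary_unimodular_imp_automorphism:
  assumes unimodular: "\<forall>\<sigma>\<in>sphere 0 1. cmod (F (0, \<sigma>)) = 1"
  shows "\<exists>\<phi>. disk_automorphism \<phi> \<and> (\<forall>z\<in>unit_disk. \<forall>w\<in>unit_disk. F (z, w) = \<phi> w)"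
proof -
  have "0 \<in> unit_disk"
    by simp
  then obtain b c where graph: "Moebius_on_graph F 0 0 b c"
    using exists_Moebius_on_graph by blast
  then have b: "cmod b = 1" and c: "cmod c = 1"
    by (simp_all add: Moebius_on_graph_def)
  have "F (z, w) = Moebius_translation (F (0, 0)) (c / b * w)"
    if z: "z \<in> unit_disk" and w: "w \<in> unit_disk" for z w
  proof -
    have "w / b \<in> unit_disk" "b * (w / b) = w"
      using b w by (auto simp: norm_divide)
    then have "F (w / b, w) = Moebius_translation (F (0, 0)) (c / b * w)"
      using Moebius_on_graph_0D[OF graph, of "w / b"] by (simp add: Moebius_function_simple)
    then show ?thesis
      using boundary_unimodular_imp_depends_on_snd[OF unimodular] z w \<open>w / b \<in> unit_disk\<close> by metis
  qed
  moreover have "disk_automorphism (\<lambda>w. Moebius_translation (F (0, 0)) (c / b * w))"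
    using maps b c by (intro disk_automorphism_Moebius_translation_rotation)
      (auto simp: norm_divide image_subset_iff)
  ultimately show ?thesis
    by blast
qed

lemma depends_on_one_variable:
  "\<exists>\<phi>. disk_automorphism \<phi> \<and>
    ((\<forall>z\<in>unit_disk. \<forall>w\<in>unit_disk. F (z, w) = \<phi> z) \<or>
     (\<forall>z\<in>unit_disk. \<forall>w\<in>unit_disk. F (z, w) = \<phi> w))"
proof (cases "\<forall>\<sigma>\<in>sphere 0 1. cmod (F (0, \<sigma>)) = 1")
  case True
  then show ?thesis
    using boundary_unimodular_imp_automorphism by blast
next
  case False
  interpret swap: continuous_extremal "F \<circ> prod.swap"
    by (rule continuous_extremal_swap)
  from False obtain \<sigma> where \<sigma>: "cmod \<sigma> = 1" "cmod (F (0, \<sigma>)) \<noteq> 1"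
    by auto
  then have "cmod (F (0, \<sigma>)) < 1"
    using norm_F_le_1[of 0 \<sigma>] by simp
  then obtain \<tau> where "cmod \<tau> = 1" "cmod (F (\<tau>, 0)) = 1"
    using exists_unimodular_boundary_value[OF \<sigma>(1)] by blast
  then have "\<forall>\<tau>\<in>sphere 0 1. cmod ((F \<circ> prod.swap) (0, \<tau>)) = 1"
    using swap.boundary_dichotomy by force
  then show ?thesis
    using swap.boundary_unimodular_imp_automorphism by auto
qed

end

theorem mainTheorem5:
  fixes f :: "complex \<times> complex \<Rightarrow> complex"
  assumes "f holomorphic2_on bidisk"
    and "f ` bidisk \<subseteq> unit_disk"
    and "everywhere_inf_extremal f"
    and "\<exists>F. continuous_on (cball 0 1 \<times> cball 0 1) F \<and> (\<forall>p\<in>bidisk. F p = f p)"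
  shows "\<exists>\<phi>. disk_automorphism \<phi> \<and>
           ((\<forall>z\<in>unit_disk. \<forall>w\<in>unit_disk. f (z, w) = \<phi> z) \<or>
            (\<forall>z\<in>unit_disk. \<forall>w\<in>unit_disk. f (z, w) = \<phi> w))"
proof -
  obtain F where cont: "continuous_on (cball 0 1 \<times> cball 0 1) F"
    and eq: "\<And>p. p \<in> bidisk \<Longrightarrow> F p = f p"
    using assms(4) by blast
  interpret continuous_extremal F
  proof
    show "F holomorphic2_on bidisk" "everywhere_inf_extremal F"
      using assms(1,3) holomorphic2_on_cong[OF eq] everywhere_inf_extremal_cong[OF eq] by simp_all
    show "F ` bidisk \<subseteq> unit_disk"
      using assms(2) eq by (simp add: image_subset_iff)
  qed (rule cont)
  show ?thesis
    using depends_on_one_variable eq by simp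
qed

end
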